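(* Let $F$ be a field with $\operatorname{Char}(F)\neq 2$ and let $R$ be a simple associative unital $F$-algebra. Let $*$ be an involution on $R$ of the first kind with set of symmetric elements $S$ and set of skew-symmetric elements $K$, and assume $S\subsetneq R$. Then: (1) If there exist $x,y\in K$ such that $xy+yx\neq 0$ and $xSy\subseteq KS+K^2$, then $KS+K^2=R$. If there exist $x,y\in K$ such that $xy+yx\neq 0$ and $xSy\subseteq SK+K^2$, then $SK+K^2=R$. (2) If there exist $x\in K$ and $y\in S$ such that $xy-yx\neq 0$ and $xSy\subseteq KS+K^2$, then $KS+K^2=R$. If there exist $x\in S$ and $y\in K$ such that $xy-yx\neq 0$ and $xSy\subseteq SK+K^2$, then $SK+K^2=R$. (3) If there exist $x\in K$ and $y\in S$ such that $xy-yx\neq 0$ and $xSy\subseteq KS$, then $KS=R$. If there exist $x\in S$ and $y\in K$ such that $xy-yx\neq 0$ and $xSy\subseteq SK$, then $SK=R$.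
   Context: $S=\{r\in R: r^*=r\}$ and $K=\{r\in R: r^*=-r\}$. The involution $*$ is of the first kind if $Z(R)\subseteq S$, where $Z(R)$ is the center of $R$. For subsets $A,B\subseteq R$, $AB$ denotes the $F$-subspace of $R$ generated by all products $ab$ with $a\in A$, $b\in B$; $K^2=KK$. The condition $xSy\subseteq B$ means $xsy\in B$ for every $s\in S$. *)

theory Defs
  imports Complex_Main "HOL-Library.Set_Algebras"
begin

text \<open>
  The carrier is a type of class \<^class>\<open>ring_1\<close>: a possibly noncommutative, associative, unital
  ring with \<open>0 \<noteq> 1\<close>. The \<open>F\<close>-algebra structure is given by an explicit scalar multiplication.
\<close>

locale unital_algebra = vector_space scale
  for scale :: "'f::field \<Rightarrow> 'r::ring_1 \<Rightarrow> 'r" +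
  assumes scale_mult_left: "scale c a * b = scale c (a * b)"
    and scale_mult_right: "a * scale c b = scale c (a * b)"

definition two_sided_ideal :: "'r::ring_1 set \<Rightarrow> bool" where
  "two_sided_ideal I \<longleftrightarrow>
     0 \<in> I \<and> (\<forall>a\<in>I. \<forall>b\<in>I. a + b \<in> I) \<and> (\<forall>a\<in>I. \<forall>r. r * a \<in> I \<and> a * r \<in> I)"

text \<open>
  No separate nonvanishing condition is needed, since \<open>0 \<noteq> 1\<close> in \<^class>\<open>ring_1\<close>. As \<open>R\<close> is
  unital, ring ideals are closed under negation and scalars, so this is simplicity both as a ring
  and as an \<open>F\<close>-algebra.
\<close>

locale simple_unital_algebra = unital_algebra scale
  for scale :: "'f::field \<Rightarrow> 'r::ring_1 \<Rightarrow> 'r" +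
  assumes simple: "two_sided_ideal (I :: 'r set) \<Longrightarrow> I = {0} \<or> I = UNIV"

definition ring_center :: "'r::ring_1 set" where
  "ring_center = {z. \<forall>r. z * r = r * z}"

definition symmetric_elements :: "('r::ring_1 \<Rightarrow> 'r) \<Rightarrow> 'r set" where
  "symmetric_elements star = {r. star r = r}"

definition skew_elements :: "('r::ring_1 \<Rightarrow> 'r) \<Rightarrow> 'r set" where
  "skew_elements star = {r. star r = - r}"

text \<open>
  Linearity over \<open>F\<close> is not part of the definition; for involutions of the first kind it is
  automatic, see \<open>involution_first_kind_scale\<close> below.
\<close>

definition involution :: "('r::ring_1 \<Rightarrow> 'r) \<Rightarrow> bool" where
  "involution star \<longleftrightarrow>
     (\<forall>a b. star (a + b) = star a + star b) \<and>
     (\<forall>a b. star (a * b) = star b * star a) \<and>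
     (\<forall>a. star (star a) = a)"

definition first_kind :: "('r::ring_1 \<Rightarrow> 'r) \<Rightarrow> bool" where
  "first_kind star \<longleftrightarrow> ring_center \<subseteq> symmetric_elements star"

lemma (in unital_algebra) involution_first_kind_scale:
  assumes "involution star" and "first_kind star"
  shows "star (scale c a) = scale c (star a)"
proof -
  have "scale c 1 \<in> ring_center"
    by (simp add: ring_center_def scale_mult_left scale_mult_right)
  then have "star (scale c 1) = scale c 1"
    using assms(2) by (auto simp: first_kind_def symmetric_elements_def)
  moreover have "star (scale c 1 * a) = star a * star (scale c 1)"
    using assms(1) by (simp add: involution_def)
  ultimately show ?thesis
    by (simp add: scale_mult_left scale_mult_right)
qed

text \<open>
  The product \<open>AB\<close> is the \<open>F\<close>-span of the elementwise product, which is what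
  \<open>A * B\<close> denotes in \<^theory>\<open>HOL-Library.Set_Algebras\<close>; likewise \<open>A + B\<close> on sets is the
  elementwise sum.
\<close>

definition span_prod :: "('f::field \<Rightarrow> 'r::ring_1 \<Rightarrow> 'r) \<Rightarrow> 'r set \<Rightarrow> 'r set \<Rightarrow> 'r set" where
  "span_prod scale A B = module.span scale (A * B)"

end

theory Submission
  imports Defs
begin

text \<open>
  Write \<open>[a, b] = a b - b a\<close>. Since \<open>2\<close> is invertible, \<open>R = S + K\<close>. For \<open>s \<in> S\<close> and \<open>k \<in> K\<close> the
  anticommutator \<open>s k + k s\<close> is skew, and \<open>K = K 1 \<subseteq> K S\<close>; hence \<open>s k\<close> and \<open>k s\<close> agree up to sign
  modulo \<open>K\<close>, which gives \<open>S K = K S\<close> (\<open>span_prod_commute\<close>).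

  Parts (1) and (2): \<open>K S + K K = K (S + K) = K R\<close>, a right ideal. It is also a left ideal: moving
  \<open>r = s + k'\<close> past \<open>k\<close> gives \<open>r k = (s k + k s) - k s + k' k \<in> K R\<close>. Since \<open>S \<noteq> R\<close>, there is a nonzero
  skew element, so \<open>K R = R\<close> by simplicity (\<open>right_ideal_of_skew\<close>).

  Part (3): put \<open>T = K S = S K\<close>. Commutators of two symmetric or of two skew elements are skew, and
  a mixed commutator lies in \<open>K S + S K\<close>, so \<open>[R, R] \<subseteq> T\<close>. Therefore membership in \<open>T\<close> is
  invariant under cyclic rotation of products, as for a trace. If \<open>x s y \<in> T\<close> for all \<open>s\<close>, where one
  of \<open>x, y\<close> is symmetric and the other skew, then rotation gives \<open>S (y x) \<subseteq> T\<close>. As \<open>x y + y x\<close> is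
  skew, \<open>S (x y + y x) \<subseteq> S K = T\<close>, and thus \<open>S a \<subseteq> T\<close> for the symmetric element \<open>a = x y - y x\<close>. Also
  \<open>K a \<subseteq> K S = T\<close>, so \<open>R a \<subseteq> T\<close>, and rotating once more \<open>R a R \<subseteq> T\<close>. When \<open>a \<noteq> 0\<close>, simplicity
  yields \<open>T = R\<close> (\<open>span_prod_skew_symmetric_eq_UNIV\<close>).
\<close>

lemma (in unital_algebra) subspace_span_prod: "subspace (span_prod scale A B)"
  by (simp add: span_prod_def)

lemma (in unital_algebra) mult_in_span_prod:
  "a \<in> A \<Longrightarrow> b \<in> B \<Longrightarrow> a * b \<in> span_prod scale A B"
  unfolding span_prod_def by (intro span_base set_times_intro)

lemma (in unital_algebra) span_prod_subset:
  assumes "subspace V" and "\<And>a b. a \<in> A \<Longrightarrow> b \<in> B \<Longrightarrow> a * b \<in> V"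
  shows "span_prod scale A B \<subseteq> V"
  unfolding span_prod_def
  by (rule span_minimal) (use assms in \<open>auto elim: set_times_elim\<close>)

lemma (in unital_algebra) subspace_set_plus:
  assumes "subspace U" and "subspace V"
  shows "subspace (U + V)"
proof -
  have "U + V = {u + v |u v. u \<in> U \<and> v \<in> V}"
    by (auto simp: set_plus_def)
  then show ?thesis
    using subspace_sums[OF assms] by simp
qed

text \<open>
  The subspace spanned by all \<open>r a r'\<close> is the two-sided ideal generated by \<open>a\<close>, so in a simple
  algebra it is everything.
\<close>

lemma (in simple_unital_algebra) subspace_eq_UNIV:
  assumes V: "subspace V" and "a \<noteq> 0" and RaR: "\<And>r r'. r * a * r' \<in> V"
  shows "V = UNIV"
proof -
  define G where "G = {r * a * r' |r r'. True}"
  have mult: "t * u \<in> span G \<and> u * t \<in> span G" if "u \<in> span G" for t u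
    using that
  proof (induction u rule: span_induct_alt)
    case base
    then show ?case by (simp add: span_zero)
  next
    case (step c g u)
    obtain r r' where g: "g = r * a * r'"
      using step(1) by (auto simp: G_def)
    have "t * g = (t * r) * a * r'" "g * t = r * a * (r' * t)"
      by (simp_all add: g mult.assoc)
    then have "t * g \<in> G" "g * t \<in> G"
      unfolding G_def by blast+
    then show ?case
      using step(2)
      by (auto simp: distrib_left distrib_right scale_mult_left scale_mult_right
          intro!: span_add span_scale intro: span_base)
  qed
  have "two_sided_ideal (span G)"
    unfolding two_sided_ideal_def using mult span_zero span_add by blast
  moreover have "a \<in> span G"
  proof -
    have "a = 1 * a * 1" by simp
    then have "a \<in> G" unfolding G_def by blast
    then show ?thesis by (rule span_base)
  qed
  ultimately have "span G = UNIV"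
    using simple \<open>a \<noteq> 0\<close> by blast
  moreover have "span G \<subseteq> V"
    using V RaR by (intro span_minimal) (auto simp: G_def)
  ultimately show ?thesis by blast
qed

locale simple_algebra_with_involution = simple_unital_algebra scale
  for scale :: "'f::field \<Rightarrow> 'r::ring_1 \<Rightarrow> 'r" +
  fixes star :: "'r \<Rightarrow> 'r"
  assumes char_not_2: "CHAR('f) \<noteq> 2"
    and star: "involution star"
    and central_symmetric: "first_kind star"
begin

abbreviation "S \<equiv> symmetric_elements star"
abbreviation "K \<equiv> skew_elements star"

lemma star_add: "star (a + b) = star a + star b"
  and star_mult: "star (a * b) = star b * star a"
  and star_star: "star (star a) = a"
  using star by (simp_all add: involution_def)

lemma star_minus: "star (- a) = - star a"
proof -
  interpret additive star by unfold_locales (rule star_add)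
  show ?thesis by (rule minus)
qed

lemma star_diff: "star (a - b) = star a - star b"
  using star_add[of a "- b"] by (simp add: star_minus)

lemma two_not_0: "(2 :: 'f) \<noteq> 0"
proof
  assume "(2 :: 'f) = 0"
  then have "of_nat 2 = (0 :: 'f)" by simp
  then have "CHAR('f) dvd 2" by (simp only: of_nat_eq_0_iff_char_dvd)
  moreover from this have "CHAR('f) \<le> 2" "CHAR('f) > 0"
    by (rule dvd_imp_le dvd_pos_nat[rotated], simp)+
  moreover have "CHAR('f) \<noteq> Suc 0" by simp
  ultimately show False
    using char_not_2 by linarith
qed

lemma scale_half_double: "scale (1 / 2) (a + a) = a"
proof -
  have "scale (1 / 2) (a + a) = scale (1 / 2 + 1 / 2) a"
    by (simp only: scale_right_distrib scale_left_distrib)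
  also have "(1 / 2 + 1 / 2 :: 'f) = 1"
    using two_not_0 by (simp add: field_simps)
  finally show ?thesis by simp
qed

lemma symmetric_plus_skew:
  obtains s k where "s \<in> S" and "k \<in> K" and "r = s + k"
proof
  note star_scale = involution_first_kind_scale[OF star central_symmetric]
  show "scale (1 / 2) (r + star r) \<in> S"
    by (simp add: symmetric_elements_def star_scale star_add star_star add.commute)
  show "scale (1 / 2) (r - star r) \<in> K"
    by (simp add: skew_elements_def star_scale star_diff star_star flip: scale_minus_right)
  show "r = scale (1 / 2) (r + star r) + scale (1 / 2) (r - star r)"
    using scale_half_double[of r] by (simp flip: scale_right_distrib)
qed

lemma anticommutator_skew:
  "s \<in> S \<Longrightarrow> k \<in> K \<Longrightarrow> s * k + k * s \<in> K"
  by (simp add: symmetric_elements_def skew_elements_def star_add star_mult)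

lemma commutator_symmetric:
  "s \<in> S \<Longrightarrow> k \<in> K \<Longrightarrow> s * k - k * s \<in> S"
  by (simp add: symmetric_elements_def skew_elements_def star_diff star_mult)

lemma one_symmetric: "1 \<in> S"
proof -
  have "star 1 = star (star 1 * 1)"
    using star_mult[of "star 1" 1] star_star[of 1] by simp
  then show ?thesis by (simp add: symmetric_elements_def star_star)
qed

lemma skew_subset_span_prod:
  "K \<subseteq> span_prod scale K S" "K \<subseteq> span_prod scale S K"
  using mult_in_span_prod[of _ K 1 S] mult_in_span_prod[of 1 S _ K] one_symmetric by auto

text \<open>
  Swapping the factors of \<open>k s\<close> changes it by the skew element \<open>s k + k s\<close> and a sign, and skew
  elements lie on both sides because \<open>1\<close> is symmetric.
\<close>

lemma span_prod_commute: "span_prod scale S K = span_prod scale K S"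
proof (intro equalityI span_prod_subset subspace_span_prod)
  fix s k assume *: "s \<in> S" "k \<in> K"
  have anti: "s * k + k * s \<in> span_prod scale K S" "s * k + k * s \<in> span_prod scale S K"
    using anticommutator_skew[OF *] skew_subset_span_prod by auto
  show "s * k \<in> span_prod scale K S"
    using subspace_diff[OF subspace_span_prod anti(1) mult_in_span_prod[OF *(2,1)]] by simp
  show "k * s \<in> span_prod scale S K"
    using subspace_diff[OF subspace_span_prod anti(2) mult_in_span_prod[OF *]] by simp
qed

text \<open>The right ideal \<open>K R\<close> absorbs \<open>R\<close> from the left too, because anticommutators are skew.\<close>

lemma right_ideal_of_skew:
  assumes "S \<noteq> UNIV"
  shows "span_prod scale K UNIV = UNIV"
proof -
  obtain t where "t \<notin> S" using assms by blast
  moreover obtain s k where t: "s \<in> S" "k \<in> K" "t = s + k"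
    by (rule symmetric_plus_skew)
  ultimately have "k \<noteq> 0" by auto
  moreover have "r * k * r' \<in> span_prod scale K UNIV" for r r'
  proof -
    obtain u l where r: "u \<in> S" "l \<in> K" "r = u + l"
      by (rule symmetric_plus_skew)
    have "r * k * r' = (u * k + k * u) * r' - k * (u * r') + l * (k * r')"
      by (simp add: r(3) algebra_simps)
    moreover have "(u * k + k * u) * r' - k * (u * r') + l * (k * r') \<in> span_prod scale K UNIV"
      by (intro subspace_add[OF subspace_span_prod] subspace_diff[OF subspace_span_prod]
          mult_in_span_prod UNIV_I)
        (fact anticommutator_skew[OF r(1) t(2)] t(2) r(2))+
    ultimately show ?thesis by simp
  qed
  ultimately show ?thesis
    by (intro subspace_eq_UNIV[of _ k] subspace_span_prod)
qed

lemma skew_symmetric_plus_skew_skew_eq_UNIV: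
  assumes "S \<noteq> UNIV"
  shows "span_prod scale K S + span_prod scale K K = UNIV"
proof -
  have "span_prod scale K UNIV \<subseteq> span_prod scale K S + span_prod scale K K"
  proof (intro span_prod_subset subspace_set_plus subspace_span_prod)
    fix k r assume "k \<in> K"
    obtain s l where r: "s \<in> S" "l \<in> K" "r = s + l"
      by (rule symmetric_plus_skew)
    show "k * r \<in> span_prod scale K S + span_prod scale K K"
      unfolding r(3) distrib_left
      using \<open>k \<in> K\<close> r(1,2) by (intro set_plus_intro mult_in_span_prod)
  qed
  then show ?thesis
    using right_ideal_of_skew[OF assms] by blast
qed

text \<open>
  Expanding along \<open>R = S + K\<close>, like-type commutators are skew and mixed ones lie in \<open>K S + S K\<close>.
  Hence the quotient map by \<open>K S\<close> behaves like a trace.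
\<close>

lemma commutator_in_span_prod: "r * t - t * r \<in> span_prod scale K S"
proof -
  let ?T = "span_prod scale K S"
  obtain s k where r: "s \<in> S" "k \<in> K" "r = s + k"
    by (rule symmetric_plus_skew)
  obtain u l where t: "u \<in> S" "l \<in> K" "t = u + l"
    by (rule symmetric_plus_skew)
  have "s * u - u * s \<in> K" "k * l - l * k \<in> K"
    using r(1,2) t(1,2)
    by (simp_all add: symmetric_elements_def skew_elements_def star_diff star_mult)
  then have "s * u - u * s \<in> ?T" "k * l - l * k \<in> ?T"
    using skew_subset_span_prod by auto
  moreover have "k * u \<in> ?T" "l * s \<in> ?T"
    using r t by (auto intro: mult_in_span_prod)
  moreover have "u * k \<in> ?T" "s * l \<in> ?T"
    using r t span_prod_commute mult_in_span_prod[of u S k K] mult_in_span_prod[of s S l K]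
    by auto
  ultimately have "s * u - u * s \<in> ?T" "k * l - l * k \<in> ?T" "k * u - u * k \<in> ?T" "s * l - l * s \<in> ?T"
    by (simp_all add: subspace_diff[OF subspace_span_prod])
  then have "(s * u - u * s) + (k * l - l * k) + (k * u - u * k) + (s * l - l * s) \<in> ?T"
    by (intro subspace_add[OF subspace_span_prod])
  then show ?thesis by (simp add: r(3) t(3) algebra_simps)
qed

lemma rotate_in_span_prod: "r * t \<in> span_prod scale K S \<Longrightarrow> t * r \<in> span_prod scale K S"
  using subspace_add[OF subspace_span_prod commutator_in_span_prod[of t r]] by fastforce

text \<open>
  By rotation \<open>K S\<close> contains the ideal generated by \<open>[s, k]\<close> as soon as it contains \<open>S k s\<close>.
\<close>

lemma span_prod_skew_symmetric_eq_UNIV: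
  assumes s: "s \<in> S" and k: "k \<in> K" and nz: "s * k \<noteq> k * s"
    and incl: "\<And>u. u \<in> S \<Longrightarrow> u * (k * s) \<in> span_prod scale K S"
  shows "span_prod scale K S = UNIV"
proof -
  let ?T = "span_prod scale K S"
  define a where "a = s * k - k * s"
  have "a \<in> S" "a \<noteq> 0"
    using commutator_symmetric[OF s k] nz by (auto simp: a_def)
  have left: "r * a \<in> ?T" for r
  proof -
    obtain u l where r: "u \<in> S" "l \<in> K" "r = u + l"
      by (rule symmetric_plus_skew)
    have "u * (s * k + k * s) \<in> ?T"
      using mult_in_span_prod[OF r(1) anticommutator_skew[OF s k]] span_prod_commute by simp
    then have "u * (s * k + k * s) - u * (k * s) - u * (k * s) + l * a \<in> ?T"
      using incl[OF r(1)] mult_in_span_prod[OF r(2) \<open>a \<in> S\<close>]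
      by (intro subspace_add subspace_diff subspace_span_prod)
    then show ?thesis by (simp add: r(3) a_def algebra_simps)
  qed
  have "r * a * r' \<in> ?T" for r r'
    using rotate_in_span_prod[of r' "r * a"] left[of "r' * r"] by (simp add: mult.assoc)
  then show ?thesis
    using \<open>a \<noteq> 0\<close> by (intro subspace_eq_UNIV[of _ a] subspace_span_prod)
qed

lemma span_prod_eq_UNIV_if_skew_S_symmetric:
  assumes "x \<in> K" "y \<in> S" "x * y - y * x \<noteq> 0"
    and incl: "\<And>s. s \<in> S \<Longrightarrow> x * s * y \<in> span_prod scale K S"
  shows "span_prod scale K S = UNIV"
proof (rule span_prod_skew_symmetric_eq_UNIV[of y x])
  let ?T = "span_prod scale K S"
  fix u assume u: "u \<in> S"
  \<comment> \<open>Rotation puts \<open>y\<close> and \<open>x\<close> in the wrong order; their anticommutator is skew, which corrects this.\<close>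
  have "u * (y * x) \<in> ?T"
    using rotate_in_span_prod[of x "u * y"] incl[OF u] by (simp add: mult.assoc)
  moreover have "u * (y * x + x * y) \<in> ?T"
    using mult_in_span_prod[OF u anticommutator_skew] assms(1,2) span_prod_commute by auto
  ultimately have "u * (y * x + x * y) - u * (y * x) \<in> ?T"
    by (intro subspace_diff subspace_span_prod)
  then show "u * (x * y) \<in> ?T" by (simp add: distrib_left)
qed (use assms in auto)

lemma span_prod_eq_UNIV_if_symmetric_S_skew:
  assumes "x \<in> S" "y \<in> K" "x * y - y * x \<noteq> 0"
    and incl: "\<And>s. s \<in> S \<Longrightarrow> x * s * y \<in> span_prod scale K S"
  shows "span_prod scale K S = UNIV"
proof (rule span_prod_skew_symmetric_eq_UNIV[of x y])
  fix u assume "u \<in> S"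
  then show "u * (y * x) \<in> span_prod scale K S"
    using rotate_in_span_prod[of x "u * y"] incl by (simp add: mult.assoc)
qed (use assms in auto)

end

theorem theorem3p7:
  fixes scale :: "'f::field \<Rightarrow> 'r::ring_1 \<Rightarrow> 'r"
    and star :: "'r \<Rightarrow> 'r"
    and S K :: "'r set"
  assumes "CHAR('f) \<noteq> 2"
    and "simple_unital_algebra scale"
    and "involution star"
    and "first_kind star"
    and "S = symmetric_elements star"
    and "K = skew_elements star"
    and "S \<subset> UNIV"
  shows
    "(((\<exists>x\<in>K. \<exists>y\<in>K. x * y + y * x \<noteq> 0 \<and>
          (\<forall>s\<in>S. x * s * y \<in> span_prod scale K S + span_prod scale K K)) \<longrightarrow>
        span_prod scale K S + span_prod scale K K = UNIV) \<and>
      ((\<exists>x\<in>K. \<exists>y\<in>K. x * y + y * x \<noteq> 0 \<and>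
          (\<forall>s\<in>S. x * s * y \<in> span_prod scale S K + span_prod scale K K)) \<longrightarrow>
        span_prod scale S K + span_prod scale K K = UNIV)) \<and>
     (((\<exists>x\<in>K. \<exists>y\<in>S. x * y - y * x \<noteq> 0 \<and>
          (\<forall>s\<in>S. x * s * y \<in> span_prod scale K S + span_prod scale K K)) \<longrightarrow>
        span_prod scale K S + span_prod scale K K = UNIV) \<and>
      ((\<exists>x\<in>S. \<exists>y\<in>K. x * y - y * x \<noteq> 0 \<and>
          (\<forall>s\<in>S. x * s * y \<in> span_prod scale S K + span_prod scale K K)) \<longrightarrow>
        span_prod scale S K + span_prod scale K K = UNIV)) \<and>
     (((\<exists>x\<in>K. \<exists>y\<in>S. x * y - y * x \<noteq> 0 \<and>
          (\<forall>s\<in>S. x * s * y \<in> span_prod scale K S)) \<longrightarrow>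
        span_prod scale K S = UNIV) \<and>
      ((\<exists>x\<in>S. \<exists>y\<in>K. x * y - y * x \<noteq> 0 \<and>
          (\<forall>s\<in>S. x * s * y \<in> span_prod scale S K)) \<longrightarrow>
        span_prod scale S K = UNIV))"
proof -
  interpret simple_algebra_with_involution scale star
    using assms(1-4)
    by (simp add: simple_algebra_with_involution_def simple_algebra_with_involution_axioms_def)
  have "symmetric_elements star \<noteq> UNIV"
    using assms(5,7) by blast
  then have KR: "span_prod scale K S + span_prod scale K K = UNIV"
    unfolding assms(5,6) by (rule skew_symmetric_plus_skew_skew_eq_UNIV)
  have comm: "span_prod scale S K = span_prod scale K S"
    unfolding assms(5,6) by (rule span_prod_commute)
  have "span_prod scale K S = UNIV"
    if "x \<in> K" "y \<in> S" "x * y - y * x \<noteq> 0" "\<forall>s\<in>S. x * s * y \<in> span_prod scale K S" for x y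
    using that span_prod_eq_UNIV_if_skew_S_symmetric[of x y] unfolding assms(5,6) by blast
  moreover have "span_prod scale K S = UNIV"
    if "x \<in> S" "y \<in> K" "x * y - y * x \<noteq> 0" "\<forall>s\<in>S. x * s * y \<in> span_prod scale K S" for x y
    using that span_prod_eq_UNIV_if_symmetric_S_skew[of x y] unfolding assms(5,6) by blast
  ultimately show ?thesis
    unfolding comm using KR by blast
qed

end
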